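(* Let $q$ be a prime power, $\mathbb{F}=\mathbb{F}_q$ and $n\ge1$. Then \[ |\mathcal{C}^{*}_{*,*}|=\sum_{k=1}^{q}(-1)^{k-1}U_k+\sum_{k=1}^{nq}(-1)^{k-1}V_k, \] where \[ U_k=n\sum_{\substack{t_1+\cdots+t_q=k\\0\le t_i\le q}}\frac{q!}{t_1!t_2!\cdots t_q!(q-k)!}q^{(q-k)q^{n-1}}=\frac{n\,q!}{(q-k)!}q^{(q-k)q^{n-1}}\sum_{\substack{t_1+\cdots+t_q=k\\0\le t_i\le q}}\frac{1}{t_1!\cdots t_q!}, \] \[ V_k=q\sum_{\substack{k_1+\cdots+k_n=k\\ 0\le k_i\le k-1,\ 0\le k_i\le q}}\Big(\prod_{j=1}^nC(q,k_j)\Big)q^{\prod_{j=1}^n(q-k_j)}. \]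
   Context: $[n]=\{1,\dots,n\}$, $C(m,k)=\frac{m!}{k!(m-k)!}$. For $i\in[n]$ and $a,b\in\mathbb{F}$, $\mathcal{C}^i_{a,b}$ denotes the set of all functions $f:\mathbb{F}^n\to\mathbb{F}$ with $f(x_1,\dots,x_{i-1},a,x_{i+1},\dots,x_n)=b$ for all $(x_1,\dots,x_n)\in\mathbb{F}^n$. $\mathcal{C}^*_{*,*}=\bigcup_{i\in[n]}\bigcup_{a\in\mathbb{F}}\bigcup_{b\in\mathbb{F}}\mathcal{C}^i_{a,b}$ is the set of all canalyzing functions $\mathbb{F}^n\to\mathbb{F}$. *)

theory Defs
  imports Complex_Main "HOL-Library.FuncSet" "HOL-Library.Cardinality" "HOL-Number_Theory.Prime_Powers"
begin

(* A point of F^n is an extensional function on {1..n}, and a function F^n -> F is an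
   extensional function on the set of such points, so that cardinalities are the intended ones. *)
definition points :: "nat \<Rightarrow> (nat \<Rightarrow> 'a) set" where
  "points n = {1..n} \<rightarrow>\<^sub>E UNIV"

definition canalyzing_at :: "nat \<Rightarrow> nat \<Rightarrow> 'a \<Rightarrow> 'a \<Rightarrow> ((nat \<Rightarrow> 'a) \<Rightarrow> 'a) set" where
  "canalyzing_at n i a b = {f \<in> points n \<rightarrow>\<^sub>E UNIV. \<forall>x\<in>points n. f (x(i := a)) = b}"

definition canalyzing :: "nat \<Rightarrow> ((nat \<Rightarrow> 'a) \<Rightarrow> 'a) set" where
  "canalyzing n = (\<Union>i\<in>{1..n}. \<Union>a\<in>UNIV. \<Union>b\<in>UNIV. canalyzing_at n i a b)"

definition U_tuples :: "nat \<Rightarrow> nat \<Rightarrow> (nat \<Rightarrow> nat) set" where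
  "U_tuples q k = {t \<in> {1..q} \<rightarrow>\<^sub>E {0..q}. (\<Sum>i=1..q. t i) = k}"

definition U_term :: "nat \<Rightarrow> nat \<Rightarrow> nat \<Rightarrow> real" where
  "U_term q n k = real n * (\<Sum>t\<in>U_tuples q k.
     fact q / ((\<Prod>i=1..q. fact (t i)) * fact (q - k)) * real q ^ ((q - k) * q ^ (n - 1)))"

definition V_tuples :: "nat \<Rightarrow> nat \<Rightarrow> nat \<Rightarrow> (nat \<Rightarrow> nat) set" where
  "V_tuples q n k =
     {\<kappa> \<in> {1..n} \<rightarrow>\<^sub>E {0..q}. (\<Sum>j=1..n. \<kappa> j) = k \<and> (\<forall>j\<in>{1..n}. \<kappa> j \<le> k - 1)}"

definition V_term :: "nat \<Rightarrow> nat \<Rightarrow> nat \<Rightarrow> real" where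
  "V_term q n k = real q * (\<Sum>\<kappa>\<in>V_tuples q n k.
     (\<Prod>j=1..n. real (q choose \<kappa> j)) * real q ^ (\<Prod>j=1..n. q - \<kappa> j))"

end

theory Submission imports Defs begin

text \<open>Apply inclusion-exclusion to the union of the sets \<open>canalyzing_at n i a b\<close>. For a set \<open>T\<close> of
triples \<open>(i, a, b)\<close> the intersection is either empty or consists of the functions with certain
prescribed values off the box \<open>\<Prod>j (F - A j)\<close>, where \<open>A j\<close> collects the \<open>a\<close> occurring in \<open>T\<close> at
coordinate \<open>j\<close>, and arbitrary values on it; so it has \<open>q ^ (\<Prod>j (q - |A j|))\<close> elements. It is nonempty in two cases only:
\<open>T\<close> lives on one coordinate and is the graph of a partial function there, which gives the \<open>U\<close> terms
(there are \<open>(q choose k) * q ^ k\<close> such graphs of size \<open>k\<close>, by the multinomial theorem the number in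
\<open>U_term\<close>), or \<open>T\<close> meets two coordinates and prescribes a single value \<open>b\<close>, which gives the \<open>V\<close>
terms.\<close>

section \<open>Multinomial sums and counting by cardinality\<close>

text \<open>Both sides are the coefficient of \<open>x^k\<close> in \<open>exp(x)^(card A)\<close>.
  The induction splits off one part and recombines by the binomial theorem. Since
  \<open>k \<le> N\<close>, the cap \<open>N\<close> excludes no tuple of sum
  \<open>k\<close>.\<close>

lemma sum_inverse_fact_multinomial:
  fixes A :: "'i set"
  assumes "finite A" "k \<le> N"
  shows "(\<Sum>t | t \<in> A \<rightarrow>\<^sub>E {0..N} \<and> sum t A = k. 1 / (\<Prod>i\<in>A. fact (t i))) =
           (real (card A) ^ k / fact k :: real)"
  using assms
proof (induction A arbitrary: k rule: finite_induct)
  case empty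
  have "{t :: 'i \<Rightarrow> nat. t \<in> {} \<rightarrow>\<^sub>E {0..N} \<and> sum t {} = k} = (if k = 0 then {\<lambda>_. undefined} else {})"
    by auto
  then show ?case
    by simp
next
  case (insert a A)
  let ?T = "\<lambda>A k. {t. t \<in> A \<rightarrow>\<^sub>E {0..N} \<and> sum t A = k}"
  have fin: "finite (?T A m)" for m
    by (rule finite_subset[of _ "A \<rightarrow>\<^sub>E {0..N}"]) (auto intro: finite_PiE insert.hyps)
  have upd: "sum (t(a := j)) A = sum t A" "(\<Prod>i\<in>A. fact ((t(a := j)) i)) = ((\<Prod>i\<in>A. fact (t i)) :: real)"
    for t :: "'i \<Rightarrow> nat" and j
    using insert.hyps by (auto intro!: sum.cong prod.cong)
  \<comment> \<open>A tuple corresponds to its value \<open>j\<close> at \<open>a\<close> together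
    with its remainder; the remainder takes the value \<open>undefined\<close> at \<open>a\<close>
    because it has to be extensional on \<open>A\<close>.\<close>
  have "(\<Sum>t\<in>?T (insert a A) k. 1 / (\<Prod>i\<in>insert a A. fact (t i)) :: real) =
        (\<Sum>(j, t)\<in>(SIGMA j:{..k}. ?T A (k - j)). 1 / (fact j * (\<Prod>i\<in>A. fact (t i))))"
    by (rule sum.reindex_bij_witness
          [where i = "\<lambda>(j, t). t(a := j)" and j = "\<lambda>t. (t a, t(a := undefined))"])
       (use insert.hyps insert.prems in
         \<open>auto simp: upd simp del: fun_upd_apply, auto simp: PiE_iff extensional_def split: if_splits\<close>)
  also have "\<dots> = (\<Sum>j\<le>k. \<Sum>t\<in>?T A (k - j). 1 / (fact j * (\<Prod>i\<in>A. fact (t i))))"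
    by (rule sum.Sigma[symmetric]) (auto simp: fin)
  also have "\<dots> = (\<Sum>j\<le>k. 1 / fact j * (\<Sum>t\<in>?T A (k - j). 1 / (\<Prod>i\<in>A. fact (t i))))"
    by (simp add: sum_distrib_left)
  also have "\<dots> = (\<Sum>j\<le>k. 1 / fact j * (real (card A) ^ (k - j) / fact (k - j)))"
    using insert by (intro sum.cong refl arg_cong2[where f = "(*)"]) auto
  \<comment> \<open>The factor \<open>1 ^ j\<close> exposes the binomial expansion of
    \<open>(1 + card A) ^ k\<close>, and \<open>1 + card A\<close> is the size of
    \<open>insert a A\<close>.\<close>
  also have "\<dots> = (\<Sum>j\<le>k. real (k choose j) * 1 ^ j * real (card A) ^ (k - j)) / fact k"
    unfolding sum_divide_distrib
    by (intro sum.cong refl) (simp add: binomial_fact field_simps)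
  also have "\<dots> = real (card (insert a A)) ^ k / fact k"
    using insert.hyps by (simp only: binomial_ring[symmetric]) simp
  finally show ?case .
qed

lemma sum_nonempty_subsets_by_card:
  fixes h :: "nat \<Rightarrow> 'b :: comm_semiring_1"
  assumes "finite S"
  shows "(\<Sum>D\<in>Pow S - {{}}. h (card D)) = (\<Sum>k=1..card S. of_nat (card S choose k) * h k)"
proof -
  have "(\<Sum>D\<in>Pow S - {{}}. h (card D)) =
        (\<Sum>k=1..card S. \<Sum>D | D \<in> Pow S - {{}} \<and> card D = k. h (card D))"
    by (rule sum.group[symmetric])
       (use assms finite_subset[OF _ assms] card_mono[OF assms] in \<open>auto simp: Suc_le_eq card_gt_0_iff\<close>)
  also have "\<dots> = (\<Sum>k=1..card S. of_nat (card S choose k) * h k)"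
  proof (intro sum.cong refl)
    fix k assume "k \<in> {1..card S}"
    then have eq: "{D. D \<in> Pow S - {{}} \<and> card D = k} = {D. D \<subseteq> S \<and> card D = k}"
      by auto
    have "(\<Sum>D | D \<subseteq> S \<and> card D = k. h (card D)) = (\<Sum>D | D \<subseteq> S \<and> card D = k. h k)"
      by (rule sum.cong) auto
    then show "(\<Sum>D | D \<in> Pow S - {{}} \<and> card D = k. h (card D)) = of_nat (card S choose k) * h k"
      using assms by (simp only: eq) (simp add: n_subsets)
  qed
  finally show ?thesis .
qed

text \<open>Group the families by their profile of cardinalities. The fibre over
  \<open>\<kappa>\<close> is a product of sets of \<open>\<kappa> j\<close>-subsets, so its size is
  a product of binomial coefficients. Restricting the profile to \<open>J\<close> makes it
  extensional, like the tuples in \<open>K\<close>.\<close>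

lemma sum_set_families_by_card:
  fixes h :: "('i \<Rightarrow> nat) \<Rightarrow> 'b :: comm_semiring_1" and K :: "('i \<Rightarrow> nat) set"
  assumes "finite J" "finite S" "K \<subseteq> J \<rightarrow>\<^sub>E {0..card S}"
  shows "(\<Sum>A | A \<in> J \<rightarrow>\<^sub>E Pow S \<and> (\<lambda>j\<in>J. card (A j)) \<in> K. h (\<lambda>j\<in>J. card (A j))) =
         (\<Sum>\<kappa>\<in>K. (\<Prod>j\<in>J. of_nat (card S choose \<kappa> j)) * h \<kappa>)"
proof -
  let ?c = "\<lambda>A. \<lambda>j\<in>J. card (A j)"
  let ?F = "{A. A \<in> J \<rightarrow>\<^sub>E Pow S \<and> ?c A \<in> K}"
  have finF: "finite ?F"
    by (rule finite_subset[of _ "J \<rightarrow>\<^sub>E Pow S"]) (auto intro: finite_PiE assms)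
  have finK: "finite K"
    by (rule finite_subset[OF assms(3)]) (auto intro: finite_PiE assms)
  have "(\<Sum>A\<in>?F. h (?c A)) = (\<Sum>\<kappa>\<in>K. \<Sum>A | A \<in> ?F \<and> ?c A = \<kappa>. h (?c A))"
    by (rule sum.group[symmetric]) (use finF finK in auto)
  also have "\<dots> = (\<Sum>\<kappa>\<in>K. (\<Prod>j\<in>J. of_nat (card S choose \<kappa> j)) * h \<kappa>)"
  proof (intro sum.cong refl)
    fix \<kappa> assume \<kappa>: "\<kappa> \<in> K"
    with assms have ext: "\<kappa> \<in> extensional J"
      by (auto simp: PiE_def)
    have eq: "{A. A \<in> ?F \<and> ?c A = \<kappa>} = (\<Pi>\<^sub>E j\<in>J. {B. B \<subseteq> S \<and> card B = \<kappa> j})"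
    proof (intro equalityI subsetI)
      fix A assume "A \<in> {A. A \<in> ?F \<and> ?c A = \<kappa>}"
      then show "A \<in> (\<Pi>\<^sub>E j\<in>J. {B. B \<subseteq> S \<and> card B = \<kappa> j})"
        by (auto simp: PiE_iff)
    next
      fix A assume A: "A \<in> (\<Pi>\<^sub>E j\<in>J. {B. B \<subseteq> S \<and> card B = \<kappa> j})"
      then have "?c A = \<kappa>"
        using ext by (auto simp: PiE_iff extensional_def fun_eq_iff)
      with A \<kappa> show "A \<in> {A. A \<in> ?F \<and> ?c A = \<kappa>}"
        by (auto simp: PiE_iff)
    qed
    have "(\<Sum>A | A \<in> ?F \<and> ?c A = \<kappa>. h (?c A)) = (\<Sum>A | A \<in> ?F \<and> ?c A = \<kappa>. h \<kappa>)"
      by (rule sum.cong) auto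
    also have "\<dots> = (\<Prod>j\<in>J. of_nat (card S choose \<kappa> j)) * h \<kappa>"
      using assms by (simp only: eq) (simp add: card_PiE n_subsets)
    finally show "(\<Sum>A | A \<in> ?F \<and> ?c A = \<kappa>. h (?c A)) = (\<Prod>j\<in>J. of_nat (card S choose \<kappa> j)) * h \<kappa>" .
  qed
  finally show ?thesis .
qed

section \<open>Intersections of canalyzing sets\<close>

lemma finite_points: "finite (points n :: (nat \<Rightarrow> 'a::finite) set)"
  by (simp add: points_def finite_PiE)

lemma finite_canalyzing_at: "finite (canalyzing_at n i a b :: ((nat \<Rightarrow> 'a::finite) \<Rightarrow> 'a) set)"
  by (rule finite_subset[of _ "points n \<rightarrow>\<^sub>E UNIV"])
     (auto simp: canalyzing_at_def intro: finite_PiE finite_points)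

lemma canalyzing_at_iff:
  assumes "i \<in> {1..n}"
  shows "f \<in> canalyzing_at n i a b \<longleftrightarrow>
           f \<in> points n \<rightarrow>\<^sub>E UNIV \<and> (\<forall>x\<in>points n. x i = a \<longrightarrow> f x = b)"
proof -
  have "x(i := a) \<in> points n" if "x \<in> points n" for x :: "nat \<Rightarrow> 'a"
    using that assms by (auto simp: points_def PiE_iff extensional_def)
  then show ?thesis
    by (auto simp: canalyzing_at_def)
qed

text \<open>The witness \<open>f0\<close> expresses that the prescriptions of \<open>T\<close> are
  consistent. Every member of the intersection agrees with \<open>f0\<close> wherever something is
  prescribed and is arbitrary elsewhere, so only the number of remaining points matters.\<close>

lemma card_Inter_canalyzing_at:
  fixes T :: "(nat \<times> 'a::finite \<times> 'a) set"
  assumes T: "T \<subseteq> {1..n} \<times> UNIV" "T \<noteq> {}"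
    and f0: "f0 \<in> (\<Inter>(i, a, b)\<in>T. canalyzing_at n i a b)"
  shows "card (\<Inter>(i, a, b)\<in>T. canalyzing_at n i a b) =
           CARD('a) ^ (\<Prod>j=1..n. CARD('a) - card {a. \<exists>b. (j, a, b) \<in> T})"
proof -
  \<comment> \<open>The union of the hyperplanes on which \<open>T\<close> prescribes a
    value.\<close>
  define Z where "Z = {x \<in> points n. \<exists>i a b. (i, a, b) \<in> T \<and> x i = a}"
  have in_T: "f \<in> (\<Inter>(i, a, b)\<in>T. canalyzing_at n i a b) \<longleftrightarrow>
      f \<in> points n \<rightarrow>\<^sub>E UNIV \<and> (\<forall>i a b x. (i, a, b) \<in> T \<longrightarrow> x \<in> points n \<longrightarrow> x i = a \<longrightarrow> f x = b)" for f
  proof -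
    have "f \<in> (\<Inter>(i, a, b)\<in>T. canalyzing_at n i a b) \<longleftrightarrow>
        (\<forall>i a b. (i, a, b) \<in> T \<longrightarrow> f \<in> canalyzing_at n i a b)"
      by auto
    also have "\<dots> \<longleftrightarrow> (\<forall>i a b. (i, a, b) \<in> T \<longrightarrow>
        f \<in> points n \<rightarrow>\<^sub>E UNIV \<and> (\<forall>x\<in>points n. x i = a \<longrightarrow> f x = b))"
      by (intro all_cong1 imp_cong refl canalyzing_at_iff) (use T(1) in auto)
    also have "\<dots> \<longleftrightarrow> f \<in> points n \<rightarrow>\<^sub>E UNIV \<and>
        (\<forall>i a b x. (i, a, b) \<in> T \<longrightarrow> x \<in> points n \<longrightarrow> x i = a \<longrightarrow> f x = b)"
    proof -
      \<comment> \<open>An empty intersection index would give the whole type; some triple in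
        \<open>T\<close> is what places \<open>f\<close> in the function space.\<close>
      have "\<exists>i a b. (i, a, b) \<in> T"
        using T(2) by auto
      then show ?thesis
        by blast
    qed
    finally show ?thesis .
  qed
  have "(\<Inter>(i, a, b)\<in>T. canalyzing_at n i a b) =
        {f \<in> points n \<rightarrow>\<^sub>E UNIV. \<forall>x\<in>Z. f x = f0 x}"
  proof (intro set_eqI iffI)
    fix f assume f: "f \<in> (\<Inter>(i, a, b)\<in>T. canalyzing_at n i a b)"
    have "f x = f0 x" if "x \<in> Z" for x
    proof -
      from that obtain i a b where "(i, a, b) \<in> T" "x \<in> points n" "x i = a"
        unfolding Z_def by blast
      with f f0 show ?thesis
        unfolding in_T by fast
    qed
    with f show "f \<in> {f \<in> points n \<rightarrow>\<^sub>E UNIV. \<forall>x\<in>Z. f x = f0 x}"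
      unfolding in_T by blast
  next
    fix f assume f: "f \<in> {f \<in> points n \<rightarrow>\<^sub>E UNIV. \<forall>x\<in>Z. f x = f0 x}"
    have "f x = b" if "(i, a, b) \<in> T" "x \<in> points n" "x i = a" for i a b x
    proof -
      have "x \<in> Z"
        using that unfolding Z_def by blast
      with f have "f x = f0 x"
        by blast
      also have "f0 x = b"
        using f0 that unfolding in_T by fast
      finally show ?thesis .
    qed
    with f show "f \<in> (\<Inter>(i, a, b)\<in>T. canalyzing_at n i a b)"
      unfolding in_T by blast
  qed
  \<comment> \<open>As a product over points, the set has one choice at each point of
    \<open>Z\<close> and \<open>CARD('a)\<close> choices at every other point.\<close>
  also have "\<dots> = (\<Pi>\<^sub>E x\<in>points n. if x \<in> Z then {f0 x} else UNIV)"
  proof -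
    have "Z \<subseteq> points n"
      by (auto simp: Z_def)
    then show ?thesis
      unfolding set_eq_iff PiE_iff mem_Collect_eq if_split_mem2 by blast
  qed
  also have "card \<dots> = (\<Prod>x\<in>points n. if x \<in> Z then 1 else CARD('a))"
    unfolding card_PiE[OF finite_points] by (rule prod.cong) auto
  also have "\<dots> = (\<Prod>x\<in>points n - Z. CARD('a))"
    by (rule prod.mono_neutral_cong_right) (auto simp: finite_points)
  also have "\<dots> = CARD('a) ^ card (points n - Z)"
    by simp
  \<comment> \<open>A point avoids all hyperplanes exactly when each coordinate avoids its own
    forbidden values; \<open>T(1)\<close> ensures that every prescription concerns a coordinate in
    \<open>{1..n}\<close>.\<close>
  also have "points n - Z = (\<Pi>\<^sub>E j\<in>{1..n}. - {a. \<exists>b. (j, a, b) \<in> T})"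
  proof (intro set_eqI iffI)
    fix x :: "nat \<Rightarrow> 'a" assume "x \<in> points n - Z"
    then show "x \<in> (\<Pi>\<^sub>E j\<in>{1..n}. - {a. \<exists>b. (j, a, b) \<in> T})"
      unfolding points_def Z_def Diff_iff mem_Collect_eq PiE_iff by blast
  next
    fix x :: "nat \<Rightarrow> 'a" assume "x \<in> (\<Pi>\<^sub>E j\<in>{1..n}. - {a. \<exists>b. (j, a, b) \<in> T})"
    with T(1) show "x \<in> points n - Z"
      unfolding points_def Z_def Diff_iff mem_Collect_eq PiE_iff by blast
  qed
  also have "card \<dots> = (\<Prod>j=1..n. CARD('a) - card {a. \<exists>b. (j, a, b) \<in> T})"
    by (simp add: card_PiE Compl_eq_Diff_UNIV card_Diff_subset)
  finally show ?thesis .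
qed

lemma card_Inter_canalyzing_at_single_coordinate:
  fixes g :: "'a::finite \<Rightarrow> 'a"
  assumes i: "i \<in> {1..n}" and D: "D \<noteq> {}"
  shows "card (\<Inter>(i, a, b)\<in>(\<lambda>a. (i, a, g a)) ` D. canalyzing_at n i a b) =
           CARD('a) ^ ((CARD('a) - card D) * CARD('a) ^ (n - 1))"
proof -
  let ?T = "(\<lambda>a. (i, a, g a)) ` D"
  have T: "?T \<subseteq> {1..n} \<times> UNIV" "?T \<noteq> {}"
    using assms by auto
  \<comment> \<open>Applying \<open>g\<close> to coordinate \<open>i\<close> satisfies all the
    prescriptions, so they are consistent.\<close>
  have f0: "(\<lambda>x\<in>points n. g (x i)) \<in> (\<Inter>(i, a, b)\<in>?T. canalyzing_at n i a b)"
    using i by (auto simp: canalyzing_at_iff)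
  \<comment> \<open>Only coordinate \<open>i\<close> loses values; each of the other
    \<open>n - 1\<close> factors remains \<open>CARD('a)\<close>.\<close>
  have coord: "{a. \<exists>b. (j, a, b) \<in> ?T} = (if j = i then D else {})" for j
    by auto
  have "(\<Prod>j=1..n. CARD('a) - card {a. \<exists>b. (j, a, b) \<in> ?T}) =
        (CARD('a) - card D) * (\<Prod>j\<in>{1..n} - {i}. CARD('a))"
    unfolding coord using i by (subst prod.remove[of _ i]) (auto intro!: prod.cong)
  also have "(\<Prod>j\<in>{1..n} - {i}. CARD('a)) = CARD('a) ^ (n - 1)"
    using i by simp
  finally show ?thesis
    using card_Inter_canalyzing_at[OF T f0] by simp
qed

lemma card_Inter_canalyzing_at_single_value:
  fixes A :: "nat \<Rightarrow> 'a::finite set"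
  assumes A: "Sigma {1..n} A \<noteq> {}"
  shows "card (\<Inter>(i, a, b)\<in>(\<lambda>(j, a). (j, a, c)) ` Sigma {1..n} A. canalyzing_at n i a b) =
           CARD('a) ^ (\<Prod>j=1..n. CARD('a) - card (A j))"
proof -
  let ?T = "(\<lambda>(j, a). (j, a, c)) ` Sigma {1..n} A"
  have T: "?T \<subseteq> {1..n} \<times> UNIV" "?T \<noteq> {}"
    using A by auto
  \<comment> \<open>With a single prescribed value, the constant function is a witness of
    consistency.\<close>
  have f0: "(\<lambda>x\<in>points n. c) \<in> (\<Inter>(i, a, b)\<in>?T. canalyzing_at n i a b)"
    by (auto simp: canalyzing_at_iff)
  have "(\<Prod>j=1..n. CARD('a) - card {a. \<exists>b. (j, a, b) \<in> ?T}) = (\<Prod>j=1..n. CARD('a) - card (A j))"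
    by (intro prod.cong refl arg_cong[where f = "\<lambda>B. CARD('a) - card B"])
       (auto simp: image_iff)
  then show ?thesis
    using card_Inter_canalyzing_at[OF T f0] by simp
qed

text \<open>Prescriptions on two different coordinates overlap in a point, which forces their values to agree.\<close>
lemma canalyzing_at_value_unique:
  fixes f :: "(nat \<Rightarrow> 'a) \<Rightarrow> 'a"
  assumes "i \<in> {1..n}" "j \<in> {1..n}" "i \<noteq> j \<or> a = a'"
    and "f \<in> canalyzing_at n i a b" "f \<in> canalyzing_at n j a' b'"
  shows "b = b'"
proof -
  \<comment> \<open>This point lies on both hyperplanes. If \<open>i = j\<close>, then
    \<open>a = a'\<close> by assumption, so \<open>x j = a'\<close> holds in that case too.\<close>
  define x where "x = (\<lambda>l\<in>{1..n}. if l = i then a else a')"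
  have "x \<in> points n" "x i = a" "x j = a'"
    using assms by (auto simp: x_def points_def)
  then show ?thesis
    using assms by (auto simp: canalyzing_at_iff)
qed

section \<open>Reading the U and V data combinatorially\<close>

text \<open>The bound \<open>k - 1\<close> in \<open>V_tuples\<close> says that no single entry
  carries the whole sum \<open>k\<close>, so at least two entries are nonzero. Starting at
  \<open>k = 1\<close> excludes the zero tuple, which truncated subtraction would admit for
  \<open>k = 0\<close>; the upper end \<open>n * q\<close> covers all possible sums.\<close>

lemma cards_in_V_tuples_iff:
  fixes A :: "nat \<Rightarrow> 'a::finite set"
  defines "q \<equiv> CARD('a)"
  shows "(\<lambda>j\<in>{1..n}. card (A j)) \<in> (\<Union>k\<in>{1..n * q}. V_tuples q n k) \<longleftrightarrow>
           (\<exists>i\<in>{1..n}. \<exists>j\<in>{1..n}. i \<noteq> j \<and> A i \<noteq> {} \<and> A j \<noteq> {})"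
    (is "?\<kappa> \<in> _ \<longleftrightarrow> ?two")
proof
  assume "?\<kappa> \<in> (\<Union>k\<in>{1..n * q}. V_tuples q n k)"
  then obtain k where k: "k \<ge> 1" "?\<kappa> \<in> V_tuples q n k"
    by auto
  then have sum: "(\<Sum>j=1..n. card (A j)) = k" and le: "\<And>j. j \<in> {1..n} \<Longrightarrow> card (A j) \<le> k - 1"
    by (auto simp: V_tuples_def)
  from sum k(1) obtain i where i: "i \<in> {1..n}" "card (A i) \<noteq> 0"
    by (metis not_one_le_zero sum.neutral)
  \<comment> \<open>Coordinate \<open>i\<close> accounts for at most \<open>k - 1\<close> of the
    sum, so another coordinate must contribute.\<close>
  have "card (A i) + (\<Sum>j\<in>{1..n} - {i}. card (A j)) = k"
    using sum i by (subst (asm) sum.remove[of _ i]) auto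
  with le[OF i(1)] k(1) have "(\<Sum>j\<in>{1..n} - {i}. card (A j)) \<noteq> 0"
    by linarith
  then obtain j where "j \<in> {1..n} - {i}" "card (A j) \<noteq> 0"
    by (metis sum.neutral)
  with i show ?two
    by force
next
  assume ?two
  then obtain i j where ij: "i \<in> {1..n}" "j \<in> {1..n}" "i \<noteq> j" "A i \<noteq> {}" "A j \<noteq> {}"
    by blast
  define k where "k = (\<Sum>j=1..n. card (A j))"
  have less: "card (A l) < k" if l: "l \<in> {1..n}" for l
  proof -
    obtain m where m: "m \<in> {1..n}" "m \<noteq> l" "A m \<noteq> {}"
      using ij by metis
    have "card (A l) + card (A m) = (\<Sum>j\<in>{l, m}. card (A j))"
      using m by simp
    also have "\<dots> \<le> k"
      unfolding k_def using l m by (intro sum_mono2) auto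
    finally show ?thesis
      using m(3) card_gt_0_iff[of "A m"] by simp
  qed
  have card_le: "card (A l) \<le> q" for l
    unfolding q_def by (simp add: card_mono)
  then have "k \<le> n * q"
    unfolding k_def using sum_bounded_above[of "{1..n}" "\<lambda>j. card (A j)" q] by simp
  moreover have "k \<ge> 1"
    using less[OF ij(1)] by simp
  moreover have "?\<kappa> \<in> V_tuples q n k"
    using less card_le by (fastforce simp: V_tuples_def k_def)
  ultimately show "?\<kappa> \<in> (\<Union>k\<in>{1..n * q}. V_tuples q n k)"
    by (auto intro!: bexI[of _ k])
qed

text \<open>The first form exhibits \<open>(q choose k) * q ^ k\<close>, the number of graphs of
  partial functions with \<open>k\<close>-element domain, and follows from the multinomial identity
  with \<open>q\<close> parts. The second is the factored expression for the same term.\<close>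

lemma U_term_altdef:
  assumes "k \<le> q"
  shows "U_term q n k = real n * (real (q choose k) * real q ^ k * real q ^ ((q - k) * q ^ (n - 1)))"
    and "U_term q n k = real n * fact q / fact (q - k) * real q ^ ((q - k) * q ^ (n - 1)) *
           (\<Sum>t\<in>U_tuples q k. 1 / (\<Prod>i=1..q. fact (t i)))"
proof -
  show *: "U_term q n k = real n * fact q / fact (q - k) * real q ^ ((q - k) * q ^ (n - 1)) *
           (\<Sum>t\<in>U_tuples q k. 1 / (\<Prod>i=1..q. fact (t i)))"
    by (simp add: U_term_def sum_distrib_left field_simps)
  have "(\<Sum>t\<in>U_tuples q k. 1 / (\<Prod>i=1..q. fact (t i))) = real q ^ k / fact k"
    using sum_inverse_fact_multinomial[of "{1..q}" k q] assms by (simp add: U_tuples_def)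
  with * show "U_term q n k = real n * (real (q choose k) * real q ^ k * real q ^ ((q - k) * q ^ (n - 1)))"
    using assms by (simp add: binomial_fact field_simps)
qed

section \<open>Inclusion-exclusion and classification of the consistent index sets\<close>

lemma card_UN_inclusion_exclusion:
  assumes "finite I" "\<And>i. i \<in> I \<Longrightarrow> finite (X i)"
  shows "real (card (\<Union>i\<in>I. X i)) =
           (\<Sum>T | T \<subseteq> I \<and> T \<noteq> {}. (- 1) ^ (card T + 1) * real (card (\<Inter>i\<in>T. X i)))"
proof -
  \<comment> \<open>Inclusion-exclusion holds for any set function additive on disjoint sets;
    cardinality is one on finite sets.\<close>
  interpret Incl_Excl finite "real \<circ> card"
    by unfold_locales (auto simp: card_Un_disjnt)
  show ?thesis
    using restricted_indexed[of I X] assms by simp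
qed

text \<open>Parameters of the one-coordinate index sets: coordinate, nonempty domain, values.
  Extensionality of the value function makes the parametrisation injective.\<close>

definition graph_indices :: "nat \<Rightarrow> (nat \<times> 'a set \<times> ('a \<Rightarrow> 'a)) set" where
  "graph_indices n = (SIGMA i:{1..n}. SIGMA D:Pow UNIV - {{}}. D \<rightarrow>\<^sub>E UNIV)"

definition graph_at :: "nat \<times> 'a set \<times> ('a \<Rightarrow> 'a) \<Rightarrow> (nat \<times> 'a \<times> 'a) set" where
  "graph_at = (\<lambda>(i, D, g). (\<lambda>a. (i, a, g a)) ` D)"

text \<open>Parameters of the index sets with one value and at least two coordinates. The latter
  condition is phrased through \<open>V_tuples\<close> so that the sum can be grouped by profiles
  directly.\<close>

definition family_indices :: "nat \<Rightarrow> ('a \<times> (nat \<Rightarrow> 'a set)) set" where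
  "family_indices n = UNIV \<times> {A \<in> {1..n} \<rightarrow>\<^sub>E Pow UNIV.
     (\<lambda>j\<in>{1..n}. card (A j)) \<in> (\<Union>k\<in>{1..n * CARD('a)}. V_tuples CARD('a) n k)}"

definition family_at :: "nat \<Rightarrow> 'a \<times> (nat \<Rightarrow> 'a set) \<Rightarrow> (nat \<times> 'a \<times> 'a) set" where
  "family_at n = (\<lambda>(c, A). (\<lambda>(j, a). (j, a, c)) ` Sigma {1..n} A)"

lemma mem_graph_at: "(j, a, b) \<in> graph_at (i, D, g) \<longleftrightarrow> j = i \<and> a \<in> D \<and> b = g a"
  by (auto simp: graph_at_def)

lemma mem_family_at: "(j, a, b) \<in> family_at n (c, A) \<longleftrightarrow> j \<in> {1..n} \<and> a \<in> A j \<and> b = c"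
  by (auto simp: family_at_def image_iff)

lemma mem_family_indices:
  "(c, A :: nat \<Rightarrow> 'a::finite set) \<in> family_indices n \<longleftrightarrow>
     A \<in> extensional {1..n} \<and> (\<exists>i\<in>{1..n}. \<exists>j\<in>{1..n}. i \<noteq> j \<and> A i \<noteq> {} \<and> A j \<noteq> {})"
  unfolding family_indices_def mem_Times_iff mem_Collect_eq fst_conv snd_conv cards_in_V_tuples_iff
  by (auto simp: PiE_def)

text \<open>Since the domain is nonempty, some triple reveals the coordinate; projecting the triples
  then recovers the domain and the values on it.\<close>

lemma inj_on_graph_at: "inj_on graph_at (graph_indices n :: (nat \<times> 'a set \<times> _) set)"
proof -
  have "i = i' \<and> D = D' \<and> g = g'"
    if idx: "(i, D, g) \<in> graph_indices n" "(i', D', g') \<in> graph_indices n"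
      and eq: "graph_at (i, D, g) = graph_at (i', D', g')"
    for i i' and D D' :: "'a set" and g g'
  proof (intro conjI)
    have mem: "j = i \<and> a \<in> D \<and> b = g a \<longleftrightarrow> j = i' \<and> a \<in> D' \<and> b = g' a" for j a b
      using eq by (simp only: mem_graph_at[symmetric])
    from idx obtain d where "d \<in> D"
      by (auto simp: graph_indices_def)
    with mem[of i d "g d"] show i: "i = i'"
      by simp
    show D: "D = D'"
      using mem[of i] i by auto
    show "g = g'"
    proof (rule extensionalityI[of _ D])
      show "g \<in> extensional D" "g' \<in> extensional D"
        using idx D by (auto simp: graph_indices_def PiE_def)
      show "g x = g' x" if "x \<in> D" for x
        using mem[of i x "g x"] that by simp
    qed
  qed
  then show ?thesis
    unfolding inj_on_def by fast
qed

lemma inj_on_family_at: "inj_on (family_at n) (family_indices n :: ('a::finite \<times> _) set)"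
proof (rule inj_onI, clarify)
  fix c c' :: 'a and A A'
  assume idx: "(c, A) \<in> family_indices n" "(c', A') \<in> family_indices n"
    and eq: "family_at n (c, A) = family_at n (c', A')"
  have mem: "j \<in> {1..n} \<and> a \<in> A j \<and> b = c \<longleftrightarrow> j \<in> {1..n} \<and> a \<in> A' j \<and> b = c'" for j a b
    using eq by (simp only: mem_family_at[symmetric])
  from idx obtain i a where "i \<in> {1..n}" "a \<in> A i"
    unfolding mem_family_indices by blast
  with mem[of i a c] have c: "c = c'"
    by simp
  have "A = A'"
  proof (rule extensionalityI[of _ "{1..n}"])
    show "A \<in> extensional {1..n}" "A' \<in> extensional {1..n}"
      using idx by (auto simp: mem_family_indices)
    show "A x = A' x" if "x \<in> {1..n}" for x
      using mem[of x _ c] that c by auto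
  qed
  with c show "c = c' \<and> A = A'"
    by simp
qed

text \<open>A graph lives on one coordinate, whereas a family meets two.\<close>

lemma graph_at_family_at_disjoint:
  "graph_at ` graph_indices n \<inter> family_at n ` (family_indices n :: ('a::finite \<times> _) set) = {}"
proof -
  have False if eq: "graph_at (i, D, g) = family_at n (c, A)" and idx: "(c, A) \<in> family_indices n"
    for i c D g and A :: "nat \<Rightarrow> 'a set"
  proof -
    obtain j j' a a' where "j \<in> {1..n}" "j' \<in> {1..n}" "j \<noteq> j'" "a \<in> A j" "a' \<in> A j'"
      using idx unfolding mem_family_indices by blast
    then have "(j, a, c) \<in> graph_at (i, D, g)" "(j', a', c) \<in> graph_at (i, D, g)"
      by (auto simp: eq mem_family_at)
    with \<open>j \<noteq> j'\<close> show False
      by (simp add: mem_graph_at)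
  qed
  then show ?thesis
    by fast
qed

text \<open>A common function \<open>f\<close> forces equal values on any two triples with different
  coordinates or the same \<open>a\<close>. On one coordinate this makes \<open>T\<close> a graph;
  with two coordinates present it makes all values equal.\<close>

lemma consistent_index_set_cases:
  fixes T :: "(nat \<times> 'a::finite \<times> 'a) set"
  assumes T: "T \<subseteq> {1..n} \<times> UNIV" "T \<noteq> {}"
    and f: "f \<in> (\<Inter>(i, a, b)\<in>T. canalyzing_at n i a b)"
  shows "T \<in> graph_at ` graph_indices n \<union> family_at n ` family_indices n"
proof -
  have unique: "b = b'" if "(i, a, b) \<in> T" "(j, a', b') \<in> T" "i \<noteq> j \<or> a = a'" for i j a a' b b'
    by (rule canalyzing_at_value_unique[of i n j a a' f]) (use that T f in auto)
  obtain i a b where iab: "(i, a, b) \<in> T"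
    using T by auto
  show ?thesis
  proof (cases "\<exists>i' a' b'. (i', a', b') \<in> T \<and> i' \<noteq> i")
    case False
    define D where "D = {a. \<exists>b. (i, a, b) \<in> T}"
    \<comment> \<open>The choice is harmless, since consistency leaves only one \<open>b\<close> for
      each \<open>a\<close>.\<close>
    define g where "g = (\<lambda>a\<in>D. SOME b. (i, a, b) \<in> T)"
    have g: "(i, a, g a) \<in> T" if "a \<in> D" for a
      using that by (auto simp: D_def g_def intro: someI)
    have "(j, d, e) \<in> T \<longleftrightarrow> j = i \<and> d \<in> D \<and> e = g d" for j d e
    proof
      assume jde: "(j, d, e) \<in> T"
      with False have "j = i"
        by blast
      with jde g unique show "j = i \<and> d \<in> D \<and> e = g d"
        by (metis (mono_tags, lifting) D_def mem_Collect_eq)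
    qed (use g in auto)
    then have "T = graph_at (i, D, g)"
      by (auto simp: set_eq_iff mem_graph_at)
    moreover have "(i, D, g) \<in> graph_indices n"
      using iab T by (auto simp: graph_indices_def D_def g_def)
    ultimately show ?thesis
      by blast
  next
    case True
    then obtain i' a' b' where i': "(i', a', b') \<in> T" "i' \<noteq> i"
      by blast
    define A where "A = (\<lambda>j\<in>{1..n}. {a. \<exists>b. (j, a, b) \<in> T})"
    \<comment> \<open>The coordinate \<open>j\<close> differs from \<open>i\<close> or from
      \<open>i'\<close>, and the triples chosen at these two coordinates already share the value
      \<open>b\<close>.\<close>
    have val: "e = b" if "(j, d, e) \<in> T" for j d e
      using unique[OF that iab] unique[OF that i'(1)] unique[OF iab i'(1)] i'(2) by metis
    have "(j, d, e) \<in> T \<longleftrightarrow> j \<in> {1..n} \<and> d \<in> A j \<and> e = b" for j d e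
      using T(1) val by (fastforce simp: A_def)
    then have "T = family_at n (b, A)"
      by (auto simp: set_eq_iff mem_family_at)
    moreover have "(b, A) \<in> family_indices n"
    proof -
      have "i \<in> {1..n}" "i' \<in> {1..n}"
        using T(1) iab i' by auto
      moreover from this have "A i \<noteq> {}" "A i' \<noteq> {}"
        using iab i' by (auto simp: A_def)
      moreover have "A \<in> extensional {1..n}"
        by (simp add: A_def)
      ultimately show ?thesis
        using i'(2) unfolding mem_family_indices by blast
    qed
    ultimately show ?thesis
      by blast
  qed
qed

section \<open>Evaluation of the two contributions\<close>

text \<open>Inclusion-exclusion runs over all nonempty sets of triples, but inconsistent ones
  contribute zero. The two consistent kinds are disjoint and injectively parametrised, so the sum
  splits and can be reindexed.\<close>

lemma card_canalyzing_split:
  fixes n :: nat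
  defines "w \<equiv> \<lambda>T :: (nat \<times> 'a::finite \<times> 'a) set.
    (- 1) ^ (card T + 1) * real (card (\<Inter>(i, a, b)\<in>T. canalyzing_at n i a b))"
  shows "real (card (canalyzing n :: ((nat \<Rightarrow> 'a) \<Rightarrow> 'a) set)) =
           (\<Sum>p\<in>graph_indices n. w (graph_at p)) + (\<Sum>p\<in>family_indices n. w (family_at n p))"
proof -
  let ?I = "{1..n} \<times> (UNIV :: ('a \<times> 'a) set)"
  let ?G = "graph_at ` graph_indices n :: (nat \<times> 'a \<times> 'a) set set"
  let ?F = "family_at n ` family_indices n :: (nat \<times> 'a \<times> 'a) set set"
  have fin: "finite {T. T \<subseteq> ?I \<and> T \<noteq> {}}"
    by (rule finite_subset[of _ "Pow ?I"]) auto
  have G: "?G \<subseteq> {T. T \<subseteq> ?I \<and> T \<noteq> {}}"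
    by (force simp: graph_indices_def graph_at_def)
  have F: "?F \<subseteq> {T. T \<subseteq> ?I \<and> T \<noteq> {}}"
    by (fastforce simp: mem_family_indices family_at_def)
  have "canalyzing n = (\<Union>(i, a, b)\<in>?I. canalyzing_at n i a b)"
    by (auto simp: canalyzing_def)
  then have "real (card (canalyzing n :: ((nat \<Rightarrow> 'a) \<Rightarrow> 'a) set)) = (\<Sum>T | T \<subseteq> ?I \<and> T \<noteq> {}. w T)"
    unfolding w_def
    by (simp only:) (rule card_UN_inclusion_exclusion, auto simp: finite_canalyzing_at)
  also have "\<dots> = (\<Sum>T\<in>?G \<union> ?F. w T)"
  proof (rule sum.mono_neutral_right[OF fin])
    show "?G \<union> ?F \<subseteq> {T. T \<subseteq> ?I \<and> T \<noteq> {}}"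
      using G F by blast
    show "\<forall>T\<in>{T. T \<subseteq> ?I \<and> T \<noteq> {}} - (?G \<union> ?F). w T = 0"
    proof
      fix T assume T: "T \<in> {T. T \<subseteq> ?I \<and> T \<noteq> {}} - (?G \<union> ?F)"
      have "(\<Inter>(i, a, b)\<in>T. canalyzing_at n i a b) = {}"
        using consistent_index_set_cases[of T n] T by blast
      then show "w T = 0"
        by (simp add: w_def)
    qed
  qed
  also have "\<dots> = (\<Sum>T\<in>?G. w T) + (\<Sum>T\<in>?F. w T)"
    by (rule sum.union_disjoint[OF finite_subset[OF G fin] finite_subset[OF F fin]
          graph_at_family_at_disjoint])
  finally show ?thesis
    by (simp add: sum.reindex inj_on_graph_at inj_on_family_at)
qed

text \<open>The weight depends only on the size \<open>k\<close> of the domain. There are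
  \<open>n\<close> coordinates, \<open>(q choose k)\<close> domains and \<open>q ^ k\<close> value
  functions on each, where \<open>q\<close> is \<open>CARD('a)\<close>.\<close>

lemma sum_graph_indices:
  fixes n :: nat
  defines "w \<equiv> \<lambda>T :: (nat \<times> 'a::finite \<times> 'a) set.
    (- 1) ^ (card T + 1) * real (card (\<Inter>(i, a, b)\<in>T. canalyzing_at n i a b))"
  shows "(\<Sum>p\<in>graph_indices n. w (graph_at p)) =
           (\<Sum>k=1..CARD('a). (- 1) ^ (k - 1) * U_term CARD('a) n k)"
proof -
  let ?q = "CARD('a)"
  let ?h = "\<lambda>k. (- 1) ^ (k + 1) * real ?q ^ ((?q - k) * ?q ^ (n - 1))"
  have w: "w (graph_at (i, D, g)) = ?h (card D)"
    if "i \<in> {1..n}" "D \<noteq> {}" for i D and g :: "'a \<Rightarrow> 'a"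
  proof -
    have "card (graph_at (i, D, g)) = card D"
      by (auto simp: graph_at_def inj_on_def intro: card_image)
    then show ?thesis
      using card_Inter_canalyzing_at_single_coordinate[OF that, of g]
      by (simp add: w_def graph_at_def)
  qed
  have "(\<Sum>p\<in>graph_indices n. w (graph_at p)) =
        (\<Sum>i=1..n. \<Sum>(D, g)\<in>(SIGMA D:Pow UNIV - {{}}. D \<rightarrow>\<^sub>E UNIV). w (graph_at (i, D, g)))"
    unfolding graph_indices_def
    by (subst sum.Sigma) (auto intro!: finite_SigmaI finite_PiE simp: split_beta)
  also have "\<dots> = (\<Sum>i=1..n. \<Sum>D\<in>Pow UNIV - {{}}. \<Sum>g\<in>D \<rightarrow>\<^sub>E UNIV. w (graph_at (i, D, g)))"
    by (intro sum.cong refl sum.Sigma[symmetric]) (auto intro!: finite_PiE)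
  also have "\<dots> = (\<Sum>i=1..n. \<Sum>D\<in>Pow (UNIV :: 'a set) - {{}}. real ?q ^ card D * ?h (card D))"
  proof (intro sum.cong refl)
    fix i D assume "i \<in> {1..n}" "D \<in> Pow (UNIV :: 'a set) - {{}}"
    then have "(\<Sum>g\<in>D \<rightarrow>\<^sub>E UNIV. w (graph_at (i, D, g))) = (\<Sum>g\<in>D \<rightarrow>\<^sub>E (UNIV :: 'a set). ?h (card D))"
      by (intro sum.cong refl w) auto
    then show "(\<Sum>g\<in>D \<rightarrow>\<^sub>E UNIV. w (graph_at (i, D, g))) = real ?q ^ card D * ?h (card D)"
      by (simp add: card_funcsetE)
  qed
  also have "\<dots> = real n * (\<Sum>k=1..?q. real (?q choose k) * (real ?q ^ k * ?h k))"
    using sum_nonempty_subsets_by_card[of "UNIV :: 'a set" "\<lambda>k. real ?q ^ k * ?h k"] by simp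
  also have "\<dots> = (\<Sum>k=1..?q. (- 1) ^ (k - 1) * U_term ?q n k)"
    unfolding sum_distrib_left
  proof (intro sum.cong refl)
    fix k assume k: "k \<in> {1..?q}"
    \<comment> \<open>The exponents have the same parity because \<open>k \<ge> 1\<close>, so
      \<open>k - 1\<close> is not truncated.\<close>
    then have "(- 1 :: real) ^ (k + 1) = (- 1) ^ (k - 1)"
      by (cases k) auto
    then show "real n * (real (?q choose k) * (real ?q ^ k * ?h k)) = (- 1) ^ (k - 1) * U_term ?q n k"
      using k by (simp add: U_term_altdef(1))
  qed
  finally show ?thesis .
qed

text \<open>The common value \<open>c\<close> does not affect the weight and yields the factor
  \<open>CARD('a)\<close> of \<open>V_term\<close>. The sign depends on the total size of the
  family, which is the index \<open>k\<close>.\<close>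

lemma sum_family_indices:
  fixes n :: nat
  defines "w \<equiv> \<lambda>T :: (nat \<times> 'a::finite \<times> 'a) set.
    (- 1) ^ (card T + 1) * real (card (\<Inter>(i, a, b)\<in>T. canalyzing_at n i a b))"
  shows "(\<Sum>p\<in>family_indices n. w (family_at n p)) =
           (\<Sum>k=1..n * CARD('a). (- 1) ^ (k - 1) * V_term CARD('a) n k)"
proof -
  let ?q = "CARD('a)"
  let ?K = "\<Union>k\<in>{1..n * ?q}. V_tuples ?q n k"
  let ?c = "\<lambda>A :: nat \<Rightarrow> 'a set. \<lambda>j\<in>{1..n}. card (A j)"
  let ?h = "\<lambda>\<kappa>. (- 1) ^ ((\<Sum>j=1..n. \<kappa> j) + 1) * real ?q ^ (\<Prod>j=1..n. ?q - \<kappa> j)"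
  let ?A = "{A. A \<in> {1..n} \<rightarrow>\<^sub>E Pow UNIV \<and> ?c A \<in> ?K}"
  have w: "w (family_at n (c, A)) = ?h (?c A)" if "(c, A) \<in> family_indices n" for c A
  proof -
    have "card (family_at n (c, A)) = (\<Sum>j=1..n. card (A j))"
      unfolding family_at_def by (subst prod.case, subst card_image) (auto simp: inj_on_def)
    moreover have "Sigma {1..n} A \<noteq> {}"
      using that by (auto simp: mem_family_indices)
    note card_Inter_canalyzing_at_single_value[OF this, of c]
    ultimately show ?thesis
      by (simp add: w_def family_at_def)
  qed
  have K: "?K \<subseteq> {1..n} \<rightarrow>\<^sub>E {0..card (UNIV :: 'a set)}"
    by (auto simp: V_tuples_def)
  have fin: "finite (V_tuples ?q n k)" for k
    by (rule finite_subset[of _ "{1..n} \<rightarrow>\<^sub>E {0..?q}"]) (auto simp: V_tuples_def intro: finite_PiE)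
  have "(\<Sum>p\<in>family_indices n. w (family_at n p)) = (\<Sum>(c, A)\<in>family_indices n. ?h (?c A))"
    by (intro sum.cong refl) (auto simp del: restrict_apply simp: w)
  also have "\<dots> = real ?q * (\<Sum>A\<in>?A. ?h (?c A))"
    unfolding family_indices_def by (subst sum.cartesian_product[symmetric]) simp
  also have "(\<Sum>A\<in>?A. ?h (?c A)) = (\<Sum>\<kappa>\<in>?K. (\<Prod>j=1..n. real (?q choose \<kappa> j)) * ?h \<kappa>)"
    by (rule sum_set_families_by_card[OF _ _ K]) auto
  \<comment> \<open>The sets \<open>V_tuples\<close> for different \<open>k\<close> are disjoint,
    since a tuple determines its sum.\<close>
  also have "\<dots> = (\<Sum>k=1..n * ?q. \<Sum>\<kappa>\<in>V_tuples ?q n k. (\<Prod>j=1..n. real (?q choose \<kappa> j)) * ?h \<kappa>)"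
    by (rule sum.UNION_disjoint) (auto simp: fin, auto simp: V_tuples_def)
  also have "real ?q * \<dots> = (\<Sum>k=1..n * ?q. (- 1) ^ (k - 1) * V_term ?q n k)"
    unfolding sum_distrib_left V_term_def
  proof (intro sum.cong refl)
    fix k \<kappa> assume k: "k \<in> {1..n * ?q}" and \<kappa>: "\<kappa> \<in> V_tuples ?q n k"
    have "(- 1 :: real) ^ (k + 1) = (- 1) ^ (k - 1)"
      using k by (cases k) auto
    moreover have "(\<Sum>j=1..n. \<kappa> j) = k"
      using \<kappa> by (simp add: V_tuples_def)
    ultimately show "real ?q * ((\<Prod>j=1..n. real (?q choose \<kappa> j)) * ?h \<kappa>) =
        (- 1) ^ (k - 1) * (real ?q * ((\<Prod>j=1..n. real (?q choose \<kappa> j)) * real ?q ^ (\<Prod>j=1..n. ?q - \<kappa> j)))"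
      by (simp add: mult_ac)
  qed
  finally show ?thesis .
qed

theorem theorem3p18:
  fixes q n :: nat
  assumes "primepow q" and "CARD('a::{field,finite}) = q" and "n \<ge> 1"
  shows "real (card (canalyzing n :: ((nat \<Rightarrow> 'a) \<Rightarrow> 'a) set)) =
           (\<Sum>k=1..q. (-1) ^ (k - 1) * U_term q n k) +
           (\<Sum>k=1..n * q. (-1) ^ (k - 1) * V_term q n k)
       \<and> (\<forall>k\<in>{1..q}. U_term q n k =
           real n * fact q / fact (q - k) * real q ^ ((q - k) * q ^ (n - 1)) *
           (\<Sum>t\<in>U_tuples q k. 1 / (\<Prod>i=1..q. fact (t i))))"
proof
  show "real (card (canalyzing n :: ((nat \<Rightarrow> 'a) \<Rightarrow> 'a) set)) =
          (\<Sum>k=1..q. (-1) ^ (k - 1) * U_term q n k) +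
          (\<Sum>k=1..n * q. (-1) ^ (k - 1) * V_term q n k)"
    unfolding card_canalyzing_split sum_graph_indices sum_family_indices
    by (simp only: \<open>CARD('a) = q\<close>)
  show "\<forall>k\<in>{1..q}. U_term q n k =
          real n * fact q / fact (q - k) * real q ^ ((q - k) * q ^ (n - 1)) *
          (\<Sum>t\<in>U_tuples q k. 1 / (\<Prod>i=1..q. fact (t i)))"
    using U_term_altdef(2) by auto
qed

end
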